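(* Let $f=(f_1,f_2,\dots)\in\ell_1$ be such that $\|f\|_{\ell_1}=1$ and $|f_j|<\frac12$ for every $j\geq 2$. Then $$\inf_{z\in f^{-1}(1)}\|P_z\|=1+\left(|f_1|+\sum_{j=1}^{+\infty}\frac{|f_{j+1}|}{1-2|f_{j+1}|}\right)^{-1}.$$
   Context: All spaces are real. $c$ is the Banach space of convergent sequences $x=(x_1,x_2,\dots)$ with the supremum norm. For $x\in c$ put $x_0=\lim_{i\to\infty}x_i$. An element $f\in\ell_1$ acts on $c$ by $f(x)=\sum_{i=0}^{\infty}f_{i+1}x_i$ (so $f_1$ multiplies the limit $x_0$). $W_f=\ker f\subset c$, $f^{-1}(1)=\{z\in c: f(z)=1\}$, and for $z\in f^{-1}(1)$, $P_z:c\to W_f$ is the projection $P_z(x)=x-f(x)z$, with $\|P_z\|$ its operator norm. *)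

theory Defs
  imports "HOL-Analysis.Analysis"
begin

section \<open>The Banach space of convergent real sequences\<close>

text \<open>The underlying sequences are indexed from 0, so that \<open>seq_of x n\<close> is the entry usually
  written $x_{n+1}$; see \<open>entry\<close> below.\<close>

typedef conv_seq = "{x :: nat \<Rightarrow> real. convergent x}"
  morphisms seq_of Conv_seq
  by (auto intro: convergent_const)

setup_lifting type_definition_conv_seq

lemma convergent_seq_of [simp]: "convergent (seq_of x)"
  using seq_of by simp

instantiation conv_seq :: real_vector
begin

lift_definition zero_conv_seq :: conv_seq is "\<lambda>_. 0"
  by (rule convergent_const)

lift_definition plus_conv_seq :: "conv_seq \<Rightarrow> conv_seq \<Rightarrow> conv_seq" is "\<lambda>x y n. x n + y n"
  by (rule convergent_add)

lift_definition uminus_conv_seq :: "conv_seq \<Rightarrow> conv_seq" is "\<lambda>x n. - x n"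
  by (simp add: convergent_minus_iff [symmetric])

lift_definition minus_conv_seq :: "conv_seq \<Rightarrow> conv_seq \<Rightarrow> conv_seq" is "\<lambda>x y n. x n - y n"
  by (rule convergent_diff)

lift_definition scaleR_conv_seq :: "real \<Rightarrow> conv_seq \<Rightarrow> conv_seq" is "\<lambda>r x n. r * x n"
  by (intro convergent_mult convergent_const)

instance
  by standard (transfer; simp add: fun_eq_iff algebra_simps)+

end

lemma bdd_above_seq_of: "bdd_above (range (\<lambda>n. \<bar>seq_of x n\<bar>))"
proof -
  have "Bseq (seq_of x)"
    by (intro convergent_imp_Bseq convergent_seq_of)
  then obtain K where "\<And>n. norm (seq_of x n) \<le> K"
    by (auto simp: Bseq_def)
  then show ?thesis
    by (intro bdd_aboveI [of _ K]) auto
qed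

instantiation conv_seq :: real_normed_vector
begin

definition norm_conv_seq :: "conv_seq \<Rightarrow> real"
  where "norm_conv_seq x = (SUP n. \<bar>seq_of x n\<bar>)"

definition sgn_conv_seq :: "conv_seq \<Rightarrow> conv_seq"
  where "sgn_conv_seq x = x /\<^sub>R norm x"

definition dist_conv_seq :: "conv_seq \<Rightarrow> conv_seq \<Rightarrow> real"
  where "dist_conv_seq x y = norm (x - y)"

definition uniformity_conv_seq :: "(conv_seq \<times> conv_seq) filter"
  where "uniformity_conv_seq = (INF e\<in>{0<..}. principal {(x, y). dist x y < e})"

definition open_conv_seq :: "conv_seq set \<Rightarrow> bool"
  where "open_conv_seq U \<longleftrightarrow> (\<forall>x\<in>U. eventually (\<lambda>(x', y). x' = x \<longrightarrow> y \<in> U) uniformity)"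

instance
proof
  have upper: "\<bar>seq_of x n\<bar> \<le> norm x" for x :: conv_seq and n
    unfolding norm_conv_seq_def by (rule cSUP_upper [OF UNIV_I bdd_above_seq_of])
  have least: "norm x \<le> K" if "\<And>n. \<bar>seq_of x n\<bar> \<le> K" for x :: conv_seq and K
    unfolding norm_conv_seq_def by (rule cSUP_least) (use that in auto)
  fix x y :: conv_seq and r :: real
  show "norm x = 0 \<longleftrightarrow> x = 0"
  proof
    assume "norm x = 0"
    then have "seq_of x n = 0" for n
      using upper [of x n] by simp
    then show "x = 0"
      by (simp add: seq_of_inject [symmetric] fun_eq_iff zero_conv_seq.rep_eq)
  qed (simp add: norm_conv_seq_def zero_conv_seq.rep_eq)
  show "norm (x + y) \<le> norm x + norm y"
  proof (rule least)
    fix n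
    show "\<bar>seq_of (x + y) n\<bar> \<le> norm x + norm y"
      using upper [of x n] upper [of y n] by (simp add: plus_conv_seq.rep_eq)
  qed
  have le: "norm (r *\<^sub>R x) \<le> \<bar>r\<bar> * norm x" for r :: real and x :: conv_seq
    by (rule least) (simp add: scaleR_conv_seq.rep_eq abs_mult mult_left_mono upper)
  show "norm (r *\<^sub>R x) = \<bar>r\<bar> * norm x"
  proof (cases "r = 0")
    case True
    then show ?thesis
      by (simp add: norm_conv_seq_def zero_conv_seq.rep_eq)
  next
    case False
    have "\<bar>r\<bar> * norm x \<le> norm (r *\<^sub>R x)"
      using le [of "inverse r" "r *\<^sub>R x"] False by (simp add: field_simps)
    with le [of r x] show ?thesis by simp
  qed
qed (simp_all add: sgn_conv_seq_def dist_conv_seq_def uniformity_conv_seq_def open_conv_seq_def)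

end

lemma abs_seq_of_le_norm: "\<bar>seq_of x n\<bar> \<le> norm x"
  unfolding norm_conv_seq_def by (rule cSUP_upper [OF UNIV_I bdd_above_seq_of])

lemma norm_conv_seq_le: "norm x \<le> K" if "\<And>n. \<bar>seq_of x n\<bar> \<le> K"
  unfolding norm_conv_seq_def by (rule cSUP_least) (use that in auto)

instance conv_seq :: banach
proof
  fix X :: "nat \<Rightarrow> conv_seq"
  assume C: "Cauchy X"
  have tail: "\<exists>M. \<forall>m\<ge>M. \<forall>k\<ge>M. \<forall>n. \<bar>seq_of (X m) n - seq_of (X k) n\<bar> < e" if "e > 0" for e
  proof -
    obtain M where M: "\<forall>m\<ge>M. \<forall>k\<ge>M. norm (X m - X k) < e"
      using C \<open>e > 0\<close> unfolding Cauchy_iff by blast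
    have "\<bar>seq_of (X m) n - seq_of (X k) n\<bar> < e" if "m \<ge> M" "k \<ge> M" for m k n
      using M that abs_seq_of_le_norm [of "X m - X k" n]
      by (fastforce simp: minus_conv_seq.rep_eq)
    then show ?thesis by blast
  qed
  define l where "l n = lim (\<lambda>m. seq_of (X m) n)" for n
  have ptw: "(\<lambda>m. seq_of (X m) n) \<longlonglongrightarrow> l n" for n
  proof -
    have "Cauchy (\<lambda>m. seq_of (X m) n)"
      unfolding Cauchy_iff using tail by (metis real_norm_def)
    then show ?thesis
      unfolding l_def by (simp add: Cauchy_convergent_iff convergent_LIMSEQ_iff)
  qed
  have unif: "\<exists>M. \<forall>m\<ge>M. \<forall>n. \<bar>seq_of (X m) n - l n\<bar> \<le> e" if "e > 0" for e
  proof -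
    obtain M where M: "\<And>m k n. m \<ge> M \<Longrightarrow> k \<ge> M \<Longrightarrow> \<bar>seq_of (X m) n - seq_of (X k) n\<bar> < e"
      using tail [OF \<open>e > 0\<close>] by blast
    have "\<bar>seq_of (X m) n - l n\<bar> \<le> e" if "m \<ge> M" for m n
    proof (rule tendsto_upperbound)
      show "(\<lambda>k. \<bar>seq_of (X m) n - seq_of (X k) n\<bar>) \<longlonglongrightarrow> \<bar>seq_of (X m) n - l n\<bar>"
        by (intro tendsto_intros ptw)
      show "\<forall>\<^sub>F k in sequentially. \<bar>seq_of (X m) n - seq_of (X k) n\<bar> \<le> e"
        using eventually_ge_at_top [of M] by eventually_elim (use M that less_imp_le in blast)
    qed simp
    then show ?thesis by blast
  qed
  have "Cauchy l"
    unfolding Cauchy_iff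
  proof (intro allI impI)
    fix e :: real
    assume "e > 0"
    obtain m where m: "\<And>n. \<bar>seq_of (X m) n - l n\<bar> \<le> e / 4"
      using unif [of "e / 4"] \<open>e > 0\<close> by auto
    have "Cauchy (seq_of (X m))"
      by (simp add: Cauchy_convergent_iff)
    then obtain N where N: "\<And>i j. i \<ge> N \<Longrightarrow> j \<ge> N \<Longrightarrow> \<bar>seq_of (X m) i - seq_of (X m) j\<bar> < e / 4"
      using \<open>e > 0\<close> unfolding Cauchy_iff real_norm_def by (metis zero_less_divide_iff zero_less_numeral)
    have "norm (l i - l j) < e" if "i \<ge> N" "j \<ge> N" for i j
      using m [of i] m [of j] N [OF that] \<open>e > 0\<close> unfolding real_norm_def by linarith
    then show "\<exists>M. \<forall>i\<ge>M. \<forall>j\<ge>M. norm (l i - l j) < e" by blast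
  qed
  then have l: "seq_of (Conv_seq l) = l"
    by (simp add: Conv_seq_inverse Cauchy_convergent_iff)
  have "X \<longlonglongrightarrow> Conv_seq l"
    unfolding LIMSEQ_iff
  proof (intro allI impI)
    fix e :: real
    assume "e > 0"
    obtain M where M: "\<And>m n. m \<ge> M \<Longrightarrow> \<bar>seq_of (X m) n - l n\<bar> \<le> e / 2"
      using unif [of "e / 2"] \<open>e > 0\<close> by auto
    have "norm (X m - Conv_seq l) \<le> e / 2" if "m \<ge> M" for m
      by (rule norm_conv_seq_le) (use M that in \<open>simp add: minus_conv_seq.rep_eq l\<close>)
    then show "\<exists>M. \<forall>m\<ge>M. norm (X m - Conv_seq l) < e"
      using \<open>e > 0\<close> by (intro exI [of _ M]) force
  qed
  then show "convergent X"
    by (rule convergentI)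
qed


section \<open>Functionals from $\ell_1$ and the associated projections\<close>

text \<open>\<open>entry x i\<close> is $x_i$, where $x_0$ is the limit of the sequence and $x_1, x_2, \dots$ are
  its terms.\<close>

definition entry :: "conv_seq \<Rightarrow> nat \<Rightarrow> real"
  where "entry x i = (case i of 0 \<Rightarrow> lim (seq_of x) | Suc n \<Rightarrow> seq_of x n)"

text \<open>Elements $f = (f_1, f_2, \dots)$ of $\ell_1$ are functions on \<open>nat\<close> of which only the values
  at indices at least 1 are ever used.\<close>

definition ell1 :: "(nat \<Rightarrow> real) set"
  where "ell1 = {f. summable (\<lambda>i. \<bar>f (i + 1)\<bar>)}"

definition ell1_norm :: "(nat \<Rightarrow> real) \<Rightarrow> real"
  where "ell1_norm f = (\<Sum>i. \<bar>f (i + 1)\<bar>)"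

definition functional :: "(nat \<Rightarrow> real) \<Rightarrow> conv_seq \<Rightarrow> real"
  where "functional f x = (\<Sum>i. f (i + 1) * entry x i)"

definition ker :: "(nat \<Rightarrow> real) \<Rightarrow> conv_seq set"
  where "ker f = {x. functional f x = 0}"

text \<open>The projection is onto the hyperplane \<open>ker f\<close> when \<open>functional f z = 1\<close>. It is
  regarded as an operator from the whole space to itself, which does not change its norm.\<close>

definition proj :: "(nat \<Rightarrow> real) \<Rightarrow> conv_seq \<Rightarrow> conv_seq \<Rightarrow> conv_seq"
  where "proj f z x = x - functional f x *\<^sub>R z"

lemma tendsto_entry_0: "seq_of x \<longlonglongrightarrow> entry x 0"
  by (simp add: entry_def convergent_LIMSEQ_iff [symmetric])

lemma abs_entry_le_norm: "\<bar>entry x i\<bar> \<le> norm x"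
proof (cases i)
  case 0
  show ?thesis unfolding 0
    by (rule tendsto_upperbound [OF tendsto_rabs [OF tendsto_entry_0]])
      (simp_all add: abs_seq_of_le_norm)
qed (simp add: entry_def abs_seq_of_le_norm)

lemma entry_add: "entry (x + y) i = entry x i + entry y i"
proof (cases i)
  case 0
  have "seq_of (x + y) \<longlonglongrightarrow> entry x 0 + entry y 0"
    unfolding plus_conv_seq.rep_eq by (intro tendsto_intros tendsto_entry_0)
  then show ?thesis
    using 0 LIMSEQ_unique tendsto_entry_0 by blast
qed (simp add: entry_def plus_conv_seq.rep_eq)

lemma entry_scaleR: "entry (r *\<^sub>R x) i = r * entry x i"
proof (cases i)
  case 0
  have "seq_of (r *\<^sub>R x) \<longlonglongrightarrow> r * entry x 0"
    unfolding scaleR_conv_seq.rep_eq by (intro tendsto_intros tendsto_entry_0)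
  then show ?thesis
    using 0 LIMSEQ_unique tendsto_entry_0 by blast
qed (simp add: entry_def scaleR_conv_seq.rep_eq)

lemma summable_functional:
  assumes "f \<in> ell1"
  shows "summable (\<lambda>i. \<bar>f (i + 1) * entry x i\<bar>)"
proof (rule summable_comparison_test')
  show "summable (\<lambda>i. \<bar>f (i + 1)\<bar> * norm x)"
    using assms by (intro summable_mult2) (simp add: ell1_def)
  show "norm \<bar>f (i + 1) * entry x i\<bar> \<le> \<bar>f (i + 1)\<bar> * norm x" if "i \<ge> 0" for i
    by (simp add: abs_mult mult_left_mono abs_entry_le_norm)
qed

lemma bounded_linear_functional:
  assumes "f \<in> ell1"
  shows "bounded_linear (functional f)"
proof (rule bounded_linear_intro)
  note S = summable_rabs_cancel [OF summable_functional [OF assms]]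
  fix x y :: conv_seq and r :: real
  show "functional f (x + y) = functional f x + functional f y"
    unfolding functional_def suminf_add [OF S S] by (simp add: entry_add distrib_left)
  show "functional f (r *\<^sub>R x) = r *\<^sub>R functional f x"
    using suminf_mult [OF S, of r x] by (simp add: functional_def entry_scaleR mult.left_commute)
  have "\<bar>functional f x\<bar> \<le> (\<Sum>i. \<bar>f (i + 1) * entry x i\<bar>)"
    unfolding functional_def by (rule summable_rabs [OF summable_functional [OF assms]])
  also have "\<dots> \<le> (\<Sum>i. norm x * \<bar>f (i + 1)\<bar>)"
    using assms
    by (intro suminf_le summable_functional summable_mult)
      (simp_all add: ell1_def abs_mult mult.commute mult_right_mono abs_entry_le_norm)
  also have "\<dots> = norm x * ell1_norm f"
    unfolding ell1_norm_def using assms by (intro suminf_mult) (simp add: ell1_def)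
  finally show "norm (functional f x) \<le> norm x * ell1_norm f" by simp
qed

lemma bounded_linear_proj:
  assumes "f \<in> ell1"
  shows "bounded_linear (proj f z)"
  unfolding proj_def
  by (intro bounded_linear_sub bounded_linear_ident
      bounded_linear_scaleR_left [THEN bounded_linear_compose] bounded_linear_functional assms)

lemma proj_in_ker:
  assumes "f \<in> ell1" "functional f z = 1"
  shows "proj f z x \<in> ker f"
proof -
  interpret bounded_linear "functional f"
    by (rule bounded_linear_functional [OF assms(1)])
  show ?thesis
    by (simp add: ker_def proj_def diff scaleR assms)
qed

lemma proj_eq_self: "x \<in> ker f \<Longrightarrow> proj f z x = x"
  by (simp add: ker_def proj_def)

end

theory Submission
  imports Defs
begin

text \<open>The operator \<open>proj f z\<close> is an infinite matrix whose \<open>n\<close>-th row, with $a = f_{n+1}$, has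
  $\ell_1$-norm $|1 - a z_n| + |z_n| (1 - |a|) \<ge> 1 + |z_n| (1 - 2|a|)$. So
  $\|P_z\| = 1 + t$ forces $|z_n| \<le> t / (1 - 2|a|)$ and, letting $n \<to> \<infinity>$, $|z_0| \<le> t$;
  inserting this in $f(z) = 1$ gives the lower bound on $t$. Equality in all these estimates
  suggests $z_n = t\, \mathrm{sgn}(a) / (1 - 2|a|)$ for $n \<ge> 1$, which need not converge to
  $z_0 = t\, \mathrm{sgn}(f_1)$; replacing the terms from index \<open>N\<close> on by the constant $z_0$ and
  rescaling gives points of the affine hyperplane that are optimal in the limit $N \<to> \<infinity>$.\<close>

section \<open>Eventually constant sequences\<close>

text \<open>A sign pattern or an ideal optimiser \<open>g\<close> may diverge; cutting it off yields
  a point of the space whose limit \<open>c\<close> is chosen independently of \<open>g\<close>. It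
  supplies the test vectors for the norm as well as the near-optimal points.\<close>

definition splice_const :: "nat \<Rightarrow> (nat \<Rightarrow> real) \<Rightarrow> real \<Rightarrow> conv_seq"
  where "splice_const N g c = Conv_seq (\<lambda>n. if n < N then g n else c)"

lemma splice_const_tendsto: "(\<lambda>n. if n < N then g n else c) \<longlonglongrightarrow> (c :: real)"
  by (rule tendsto_eventually) (auto simp: eventually_sequentially intro: exI [of _ N])

lemma seq_of_splice_const: "seq_of (splice_const N g c) = (\<lambda>n. if n < N then g n else c)"
  unfolding splice_const_def
  using splice_const_tendsto [THEN convergentI] by (intro Conv_seq_inverse) simp

lemma entry_Suc: "entry x (Suc n) = seq_of x n"
  by (simp add: entry_def)

lemma entry_0_splice_const: "entry (splice_const N g c) 0 = c"
  by (rule LIMSEQ_unique [OF tendsto_entry_0])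
    (simp add: seq_of_splice_const splice_const_tendsto)

section \<open>Estimates for the functional\<close>

lemma ell1_summable:
  assumes "f \<in> ell1"
  shows "summable (\<lambda>n. \<bar>f (n + 2)\<bar>)"
proof -
  have "summable (\<lambda>i. \<bar>f (i + 1)\<bar>)"
    using assms by (simp add: ell1_def)
  then have "summable (\<lambda>i. \<bar>f (Suc i + 1)\<bar>)"
    by (subst summable_Suc_iff)
  then show ?thesis by simp
qed

lemma ell1_norm_split:
  assumes "f \<in> ell1"
  shows "ell1_norm f = \<bar>f 1\<bar> + (\<Sum>n. \<bar>f (n + 2)\<bar>)"
  using suminf_split_head [of "\<lambda>i. \<bar>f (i + 1)\<bar>"] assms by (simp add: ell1_norm_def ell1_def)

lemma functional_split:
  assumes "f \<in> ell1"
  shows "functional f x = f 1 * entry x 0 + (\<Sum>n. f (n + 2) * seq_of x n)"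
  using suminf_split_head [OF summable_rabs_cancel [OF summable_functional [OF assms]], of x]
  by (simp add: functional_def entry_Suc)

lemma abs_functional_le:
  assumes "f \<in> ell1"
  shows "\<bar>functional f x\<bar> \<le> ell1_norm f * norm x"
proof -
  have S: "summable (\<lambda>i. \<bar>f (i + 1)\<bar>)"
    using assms by (simp add: ell1_def)
  have "\<bar>functional f x\<bar> \<le> (\<Sum>i. \<bar>f (i + 1) * entry x i\<bar>)"
    unfolding functional_def by (rule summable_rabs [OF summable_functional [OF assms]])
  also have "\<dots> \<le> (\<Sum>i. \<bar>f (i + 1)\<bar> * norm x)"
    by (intro suminf_le summable_functional summable_mult2 S assms)
      (simp_all add: abs_mult mult_left_mono abs_entry_le_norm)
  also have "\<dots> = ell1_norm f * norm x"
    unfolding ell1_norm_def by (rule suminf_mult2 [OF S, symmetric])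
  finally show ?thesis .
qed

text \<open>Deleting one coefficient of \<open>f\<close> gives another element of
  \<open>ell1\<close>, whose norm is smaller by exactly the deleted absolute value; the general norm
  bound is applied to it.\<close>

lemma abs_functional_diff_le:
  assumes "f \<in> ell1"
  shows "\<bar>functional f x - f (n + 2) * seq_of x n\<bar> \<le> (ell1_norm f - \<bar>f (n + 2)\<bar>) * norm x"
proof -
  define h where "h = f(n + 2 := 0)"
  \<comment> \<open>\<open>seq_of x n\<close> is \<open>entry x (n + 1)\<close>, so it sits in the
    series term \<open>i = n + 1\<close>, whose coefficient is \<open>f (n + 1 + 1)\<close>.\<close>
  have idx: "n + 1 + 1 = n + 2" by simp
  have "(\<lambda>i. \<bar>f (i + 1)\<bar>) sums ell1_norm f"
    using assms by (simp add: ell1_def ell1_norm_def summable_sums)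
  then have "(\<lambda>i. \<bar>f (i + 1)\<bar> - (if i = n + 1 then \<bar>f (i + 1)\<bar> else 0)) sums
      (ell1_norm f - \<bar>f (n + 1 + 1)\<bar>)"
    by (intro sums_diff sums_single)
  then have N: "(\<lambda>i. \<bar>h (i + 1)\<bar>) sums (ell1_norm f - \<bar>f (n + 2)\<bar>)"
    unfolding idx by (rule sums_cong [THEN iffD1, rotated]) (auto simp: h_def)
  have "(\<lambda>i. f (i + 1) * entry x i) sums functional f x"
    unfolding functional_def
    by (rule summable_sums [OF summable_rabs_cancel [OF summable_functional [OF assms]]])
  then have "(\<lambda>i. f (i + 1) * entry x i - (if i = n + 1 then f (i + 1) * entry x i else 0)) sums
      (functional f x - f (n + 1 + 1) * entry x (n + 1))"
    by (intro sums_diff sums_single)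
  then have F: "(\<lambda>i. h (i + 1) * entry x i) sums (functional f x - f (n + 2) * seq_of x n)"
    unfolding idx by (subst (asm) sums_cong [where g = "\<lambda>i. h (i + 1) * entry x i"])
      (auto simp: h_def entry_Suc)
  have "h \<in> ell1"
    using N by (auto simp: ell1_def sums_iff)
  from abs_functional_le [OF this, of x] show ?thesis
    using N F by (simp add: ell1_norm_def functional_def sums_iff)
qed

section \<open>Upper bound for one row of the projection\<close>

lemma seq_of_proj: "seq_of (proj f z x) n = seq_of x n - functional f x * seq_of z n"
  by (simp add: proj_def minus_conv_seq.rep_eq scaleR_conv_seq.rep_eq)

lemma abs_seq_of_proj_le:
  assumes "f \<in> ell1"
  shows "\<bar>seq_of (proj f z x) n\<bar> \<le>
    (\<bar>1 - f (n + 2) * seq_of z n\<bar> + \<bar>seq_of z n\<bar> * (ell1_norm f - \<bar>f (n + 2)\<bar>)) * norm x"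
proof -
  let ?r = "functional f x - f (n + 2) * seq_of x n"
  have "seq_of (proj f z x) n = (1 - f (n + 2) * seq_of z n) * seq_of x n - seq_of z n * ?r"
    by (simp add: seq_of_proj algebra_simps)
  then have "\<bar>seq_of (proj f z x) n\<bar> \<le>
      \<bar>1 - f (n + 2) * seq_of z n\<bar> * \<bar>seq_of x n\<bar> + \<bar>seq_of z n\<bar> * \<bar>?r\<bar>"
    by (metis abs_mult abs_triangle_ineq4)
  also have "\<dots> \<le> \<bar>1 - f (n + 2) * seq_of z n\<bar> * norm x +
      \<bar>seq_of z n\<bar> * ((ell1_norm f - \<bar>f (n + 2)\<bar>) * norm x)"
    by (intro add_mono mult_left_mono abs_seq_of_le_norm abs_functional_diff_le assms) auto
  finally show ?thesis by (simp add: algebra_simps)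
qed

section \<open>Lower bound for the norm from one row\<close>

text \<open>The terms from \<open>N\<close> on contribute \<open>c\<close> times a tail of the
  summable \<open>f\<close>, which vanishes in the limit; \<open>f 1\<close> sees \<open>c\<close>
  for every \<open>N\<close>.\<close>

lemma functional_splice_const_tendsto:
  assumes f: "f \<in> ell1" and g: "summable (\<lambda>n. f (n + 2) * g n)"
  shows "(\<lambda>N. functional f (splice_const N g c)) \<longlonglongrightarrow> f 1 * c + (\<Sum>n. f (n + 2) * g n)"
proof -
  have S: "summable (\<lambda>n. f (n + 2))"
    by (rule summable_rabs_cancel [OF ell1_summable [OF f]])
  have eq: "functional f (splice_const N g c) =
      f 1 * c + ((\<Sum>n<N. f (n + 2) * g n) + c * ((\<Sum>n. f (n + 2)) - (\<Sum>n<N. f (n + 2))))" for N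
  proof -
    \<comment> \<open>The spliced sequence is the constant \<open>c\<close> corrected in finitely
      many terms.\<close>
    have "(\<lambda>n. f (n + 2) * c + (if n < N then f (n + 2) * (g n - c) else 0)) sums
        ((\<Sum>n. f (n + 2)) * c + (\<Sum>n | n < N. f (n + 2) * (g n - c)))"
      by (intro sums_add sums_mult2 summable_sums S sums_If_finite) simp
    then have "(\<lambda>n. f (n + 2) * seq_of (splice_const N g c) n) sums
        ((\<Sum>n. f (n + 2)) * c + (\<Sum>n | n < N. f (n + 2) * (g n - c)))"
      by (rule sums_cong [THEN iffD1, rotated]) (auto simp: seq_of_splice_const algebra_simps)
    then show ?thesis
      by (simp add: functional_split [OF f] entry_0_splice_const sums_iff lessThan_def [symmetric]
          sum_subtractf sum_distrib_left sum_distrib_right algebra_simps)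
  qed
  have "(\<lambda>N. f 1 * c + ((\<Sum>n<N. f (n + 2) * g n) + c * ((\<Sum>n. f (n + 2)) - (\<Sum>n<N. f (n + 2)))))
      \<longlonglongrightarrow> f 1 * c + ((\<Sum>n. f (n + 2) * g n) + c * ((\<Sum>n. f (n + 2)) - (\<Sum>n. f (n + 2))))"
    by (intro tendsto_intros summable_LIMSEQ S g)
  then show ?thesis by (simp add: eq)
qed

text \<open>The test vectors are opposite in sign to \<open>f\<close>, except that coordinate
  \<open>n\<close> follows the sign of \<open>z\<close>. Then \<open>x\<close> and
  \<open>- functional f x *\<^sub>R z\<close> add up without cancellation at coordinate
  \<open>n\<close>, up to the limit in the truncation index.\<close>

lemma onorm_proj_ge:
  assumes f: "f \<in> ell1"
  shows "1 + \<bar>seq_of z n\<bar> * (ell1_norm f - 2 * \<bar>f (n + 2)\<bar>) \<le> onorm (proj f z)"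
proof -
  \<comment> \<open>Unlike \<open>sgn\<close>, this takes the value 1 at 0, so that
    \<open>e * e = 1\<close> always holds.\<close>
  define e where "e = (if seq_of z n \<ge> 0 then 1 else - 1 :: real)"
  have e: "\<bar>e\<bar> = 1"
    by (simp add: e_def)
  define g where "g i = (if i = n then e else - sgn (f (i + 2)))" for i
  define x where "x N = splice_const N g (- sgn (f 1))" for N
  \<comment> \<open>The increase of the functional when term \<open>n\<close> of the pattern is
    changed from \<open>- sgn (f (n + 2))\<close> to \<open>e\<close>.\<close>
  define d where "d = f (n + 2) * e + \<bar>f (n + 2)\<bar>"
  have "(\<lambda>i. - \<bar>f (i + 2)\<bar> + (if i = n then d else 0)) sums (- (\<Sum>i. \<bar>f (i + 2)\<bar>) + d)"
    by (intro sums_add sums_minus summable_sums ell1_summable f sums_single)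
  then have G: "(\<lambda>i. f (i + 2) * g i) sums (- (\<Sum>i. \<bar>f (i + 2)\<bar>) + d)"
    by (rule sums_cong [THEN iffD1, rotated]) (auto simp: g_def d_def abs_sgn)
  have "(\<lambda>N. functional f (x N)) \<longlonglongrightarrow> f 1 * (- sgn (f 1)) + (\<Sum>i. f (i + 2) * g i)"
    unfolding x_def by (rule functional_splice_const_tendsto [OF f sums_summable [OF G]])
  also have "f 1 * (- sgn (f 1)) + (\<Sum>i. f (i + 2) * g i) = d - ell1_norm f"
    using G ell1_norm_split [OF f] by (simp add: sums_iff abs_sgn)
  finally have lim: "(\<lambda>N. functional f (x N)) \<longlonglongrightarrow> d - ell1_norm f" .
  have nx: "norm (x N) \<le> 1" for N
    by (rule norm_conv_seq_le) (auto simp: x_def seq_of_splice_const g_def e abs_sgn_eq)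
  have le: "1 - functional f (x N) * \<bar>seq_of z n\<bar> \<le> onorm (proj f z)" if "N > n" for N
  proof -
    have "seq_of (x N) n = e"
      using that by (simp add: x_def seq_of_splice_const g_def)
    then have "e * seq_of (proj f z (x N)) n = e * e - functional f (x N) * (e * seq_of z n)"
      by (simp add: seq_of_proj algebra_simps)
    also have "\<dots> = 1 - functional f (x N) * \<bar>seq_of z n\<bar>"
      by (simp add: e_def)
    finally have "e * seq_of (proj f z (x N)) n = 1 - functional f (x N) * \<bar>seq_of z n\<bar>" .
    then have "1 - functional f (x N) * \<bar>seq_of z n\<bar> \<le> \<bar>seq_of (proj f z (x N)) n\<bar>"
      using e by (metis abs_ge_self abs_mult mult_1)
    also have "\<dots> \<le> onorm (proj f z) * norm (x N)"
      by (rule order_trans [OF abs_seq_of_le_norm onorm [OF bounded_linear_proj [OF f]]])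
    also have "\<dots> \<le> onorm (proj f z) * 1"
      by (intro mult_left_mono nx onorm_pos_le bounded_linear_proj f)
    finally show ?thesis by simp
  qed
  have "d \<le> 2 * \<bar>f (n + 2)\<bar>"
    by (auto simp: d_def e_def)
  then have "(ell1_norm f - 2 * \<bar>f (n + 2)\<bar>) * \<bar>seq_of z n\<bar> \<le> (ell1_norm f - d) * \<bar>seq_of z n\<bar>"
    by (intro mult_right_mono) auto
  then have "1 + \<bar>seq_of z n\<bar> * (ell1_norm f - 2 * \<bar>f (n + 2)\<bar>) \<le>
      1 - (d - ell1_norm f) * \<bar>seq_of z n\<bar>"
    by (simp add: algebra_simps)
  also have "\<dots> \<le> onorm (proj f z)"
  proof (rule tendsto_upperbound)
    show "(\<lambda>N. 1 - functional f (x N) * \<bar>seq_of z n\<bar>) \<longlonglongrightarrow> 1 - (d - ell1_norm f) * \<bar>seq_of z n\<bar>"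
      by (intro tendsto_intros lim)
    show "\<forall>\<^sub>F N in sequentially. 1 - functional f (x N) * \<bar>seq_of z n\<bar> \<le> onorm (proj f z)"
      using eventually_gt_at_top [of n] by eventually_elim (rule le)
  qed simp
  finally show ?thesis .
qed

section \<open>Lower bound for every projection\<close>

text \<open>Coefficients tend to 0, so the denominators are eventually above 1/2 and the terms are
  dominated by \<open>2 * \<bar>f (n + 2)\<bar>\<close>.\<close>

lemma summable_weights:
  assumes f: "f \<in> ell1"
  shows "summable (\<lambda>n. \<bar>f (n + 2)\<bar> / (1 - 2 * \<bar>f (n + 2)\<bar>))"
proof (rule summable_comparison_test_ev)
  have S: "summable (\<lambda>n. \<bar>f (n + 2)\<bar>)"
    by (rule ell1_summable [OF f])
  have "\<forall>\<^sub>F n in sequentially. \<bar>f (n + 2)\<bar> < 1 / 4"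
    using summable_LIMSEQ_zero [OF S] by (rule order_tendstoD) simp
  then show "\<forall>\<^sub>F n in sequentially. norm (\<bar>f (n + 2)\<bar> / (1 - 2 * \<bar>f (n + 2)\<bar>)) \<le> 2 * \<bar>f (n + 2)\<bar>"
  proof eventually_elim
    case (elim n)
    then have "\<bar>f (n + 2)\<bar> * 1 \<le> \<bar>f (n + 2)\<bar> * (2 * (1 - 2 * \<bar>f (n + 2)\<bar>))"
      by (intro mult_left_mono) auto
    with elim show ?case
      by (simp add: pos_divide_le_eq algebra_simps)
  qed
  show "summable (\<lambda>n. 2 * \<bar>f (n + 2)\<bar>)"
    by (rule summable_mult [OF S])
qed

lemma onorm_proj_lower_bound:
  assumes f: "f \<in> ell1" and norm: "ell1_norm f = 1" and small: "\<And>n. \<bar>f (n + 2)\<bar> < 1 / 2"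
    and z: "functional f z = 1"
  shows "1 \<le> (onorm (proj f z) - 1) * (\<bar>f 1\<bar> + (\<Sum>n. \<bar>f (n + 2)\<bar> / (1 - 2 * \<bar>f (n + 2)\<bar>)))"
proof -
  define t where "t = onorm (proj f z) - 1"
  have ge: "\<bar>seq_of z n\<bar> * (1 - 2 * \<bar>f (n + 2)\<bar>) \<le> t" for n
    using onorm_proj_ge [OF f, of z n] by (simp add: norm t_def)
  \<comment> \<open>As the coefficients vanish, the factor tends to 1; this is why
    \<open>\<bar>f 1\<bar>\<close> enters the final sum without a denominator.\<close>
  have "(\<lambda>n. \<bar>seq_of z n\<bar> * (1 - 2 * \<bar>f (n + 2)\<bar>)) \<longlonglongrightarrow> \<bar>entry z 0\<bar> * (1 - 2 * 0)"
    by (intro tendsto_intros tendsto_entry_0 summable_LIMSEQ_zero ell1_summable f)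
  then have z0: "\<bar>entry z 0\<bar> \<le> t"
    using ge by (intro tendsto_upperbound) auto
  have zn: "\<bar>f (n + 2) * seq_of z n\<bar> \<le> t * (\<bar>f (n + 2)\<bar> / (1 - 2 * \<bar>f (n + 2)\<bar>))" for n
  proof -
    have "\<bar>seq_of z n\<bar> \<le> t / (1 - 2 * \<bar>f (n + 2)\<bar>)"
      using ge [of n] small [of n] by (simp add: pos_le_divide_eq)
    then have "\<bar>f (n + 2)\<bar> * \<bar>seq_of z n\<bar> \<le> \<bar>f (n + 2)\<bar> * (t / (1 - 2 * \<bar>f (n + 2)\<bar>))"
      by (rule mult_left_mono) simp
    then show ?thesis by (simp add: abs_mult mult.commute)
  qed
  have Sz: "summable (\<lambda>n. \<bar>f (n + 2) * seq_of z n\<bar>)"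
    by (rule summable_comparison_test' [OF summable_mult [OF summable_weights [OF f], of t], of 0])
      (use zn in simp)
  have "1 = f 1 * entry z 0 + (\<Sum>n. f (n + 2) * seq_of z n)"
    using z functional_split [OF f] by simp
  also have "\<dots> \<le> \<bar>f 1\<bar> * \<bar>entry z 0\<bar> + (\<Sum>n. \<bar>f (n + 2) * seq_of z n\<bar>)"
    by (intro add_mono suminf_le Sz summable_rabs_cancel [OF Sz])
      (simp_all add: abs_mult [symmetric])
  also have "\<dots> \<le> \<bar>f 1\<bar> * t + (\<Sum>n. t * (\<bar>f (n + 2)\<bar> / (1 - 2 * \<bar>f (n + 2)\<bar>)))"
    by (intro add_mono mult_left_mono z0 suminf_le Sz summable_mult summable_weights f zn) simp
  also have "\<dots> = t * (\<bar>f 1\<bar> + (\<Sum>n. \<bar>f (n + 2)\<bar> / (1 - 2 * \<bar>f (n + 2)\<bar>)))"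
    by (subst suminf_mult [OF summable_weights [OF f]]) (simp add: algebra_simps)
  finally show ?thesis by (simp add: t_def)
qed

section \<open>Near-optimal points of the affine hyperplane\<close>

text \<open>The truncated optimiser \<open>y N\<close> has functional value \<open>T N\<close>
  tending to \<open>S\<close>. Dividing by \<open>T N\<close>, which is positive for large
  \<open>N\<close>, puts it on the hyperplane, and every row norm is then at most
  \<open>1 + inverse (T N)\<close>.\<close>

lemma exists_near_optimal:
  assumes f: "f \<in> ell1" and norm: "ell1_norm f = 1" and small: "\<And>n. \<bar>f (n + 2)\<bar> < 1 / 2"
  defines "S \<equiv> \<bar>f 1\<bar> + (\<Sum>n. \<bar>f (n + 2)\<bar> / (1 - 2 * \<bar>f (n + 2)\<bar>))"
  assumes S: "S > 0"
  obtains s z where "s \<longlonglongrightarrow> inverse S"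
    "\<forall>\<^sub>F N in sequentially. functional f (z N) = 1 \<and> onorm (proj f (z N)) \<le> 1 + s N"
proof -
  define w where "w n = \<bar>f (n + 2)\<bar> / (1 - 2 * \<bar>f (n + 2)\<bar>)" for n
  define g where "g n = sgn (f (n + 2)) / (1 - 2 * \<bar>f (n + 2)\<bar>)" for n
  have fg: "f (n + 2) * g n = w n" for n
    by (simp add: g_def w_def abs_sgn)
  have w: "summable w" "w n \<ge> 0" for n
    using summable_weights [OF f] small [of n] by (simp_all add: w_def [abs_def])
  define y where "y N = splice_const N g (sgn (f 1))" for N
  define T where "T N = functional f (y N)" for N
  have S_eq: "S = \<bar>f 1\<bar> + suminf w"
    by (simp add: S_def w_def [abs_def])
  have T: "T \<longlonglongrightarrow> S"
    using functional_splice_const_tendsto [OF f, of g "sgn (f 1)"] w(1)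
    unfolding T_def [abs_def] y_def fg S_eq abs_sgn by simp
  \<comment> \<open>The contribution of the constant tail to \<open>T N\<close>.\<close>
  define q where "q N = sgn (f 1) * (\<Sum>n. f (n + N + 2))" for N
  have Tq: "T N = \<bar>f 1\<bar> + sum w {..<N} + q N" for N
  proof -
    have Sf: "summable (\<lambda>n. f (n + 2))"
      by (rule summable_rabs_cancel [OF ell1_summable [OF f]])
    have Sy: "summable (\<lambda>n. f (n + 2) * seq_of (y N) n)"
    proof -
      have "summable (\<lambda>n. f (n + N + 2) * sgn (f 1))"
        by (rule summable_mult2) (use summable_ignore_initial_segment [OF Sf, of N] in simp)
      then have "summable (\<lambda>n. f (n + N + 2) * seq_of (y N) (n + N))"
        by (simp add: y_def seq_of_splice_const)
      then show ?thesis
        by (subst summable_iff_shift [symmetric, of _ N])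
    qed
    have "(\<Sum>n. f (n + 2) * seq_of (y N) n) =
        (\<Sum>n. f (n + N + 2) * seq_of (y N) (n + N)) + (\<Sum>n<N. f (n + 2) * seq_of (y N) n)"
      using suminf_split_initial_segment [OF Sy, of N] by simp
    also have "(\<Sum>n<N. f (n + 2) * seq_of (y N) n) = sum w {..<N}"
      by (intro sum.cong) (auto simp: y_def seq_of_splice_const fg [simplified])
    also have "(\<Sum>n. f (n + N + 2) * seq_of (y N) (n + N)) = q N"
      using suminf_mult [OF summable_ignore_initial_segment [OF Sf, of N], of "sgn (f 1)"]
      by (simp add: y_def seq_of_splice_const q_def mult.commute)
    finally show ?thesis
      by (simp add: T_def functional_split [OF f] y_def entry_0_splice_const abs_sgn)
  qed
  have "\<forall>\<^sub>F N in sequentially. \<bar>f 1\<bar> + q N \<ge> 0"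
  \<comment> \<open>This sign will give \<open>w n \<le> T N\<close> for \<open>n < N\<close>. If
    \<open>f 1 = 0\<close>, then \<open>q N\<close> vanishes because \<open>sgn 0 = 0\<close>;
    otherwise \<open>q N\<close> tends to 0 while \<open>\<bar>f 1\<bar>\<close> is
    positive.\<close>
  proof (cases "f 1 = 0")
    case False
    have "(\<lambda>N. T N - sum w {..<N}) \<longlonglongrightarrow> S - suminf w"
      by (intro tendsto_intros T summable_LIMSEQ w)
    then have "(\<lambda>N. \<bar>f 1\<bar> + q N) \<longlonglongrightarrow> \<bar>f 1\<bar>"
      by (simp add: Tq S_eq)
    then have "\<forall>\<^sub>F N in sequentially. \<bar>f 1\<bar> + q N > 0"
      by (rule order_tendstoD) (use False in simp)
    then show ?thesis by eventually_elim simp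
  qed (simp add: q_def)
  moreover have "\<forall>\<^sub>F N in sequentially. T N > 0"
    using T S by (rule order_tendstoD)
  ultimately have "\<forall>\<^sub>F N in sequentially. functional f (inverse (T N) *\<^sub>R y N) = 1 \<and>
      onorm (proj f (inverse (T N) *\<^sub>R y N)) \<le> 1 + inverse (T N)"
  proof eventually_elim
    case (elim N)
    define s where "s = inverse (T N)"
    have s: "s > 0" "s * T N = 1"
      using elim by (simp_all add: s_def)
    interpret bounded_linear "functional f"
      by (rule bounded_linear_functional [OF f])
    have "functional f (s *\<^sub>R y N) = 1"
      using s by (simp add: scaleR T_def)
    moreover have "onorm (proj f (s *\<^sub>R y N)) \<le> 1 + s"
    proof (rule onorm_bound)
      fix x
      show "norm (proj f (s *\<^sub>R y N) x) \<le> (1 + s) * norm x"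
      proof (rule norm_conv_seq_le)
        fix n
        let ?a = "f (n + 2)" and ?z = "seq_of (s *\<^sub>R y N) n"
        have "\<bar>1 - ?a * ?z\<bar> + \<bar>?z\<bar> * (1 - \<bar>?a\<bar>) \<le> 1 + s"
        proof (cases "n < N")
          case True
          then have z: "?z = s * g n"
            by (simp add: y_def seq_of_splice_const scaleR_conv_seq.rep_eq)
          \<comment> \<open>It follows that \<open>s * w n \<le> 1\<close>, so the diagonal entry is
            nonnegative and the row norm equals
            \<open>1 + \<bar>?z\<bar> * (1 - 2 * \<bar>?a\<bar>)\<close>.\<close>
          have "w n \<le> sum w {..<N}"
            using True w by (intro member_le_sum) auto
          then have "w n \<le> T N"
            using elim by (simp add: Tq)
          then have "s * w n \<le> s * T N"
            using s by (intro mult_left_mono) auto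
          moreover have az: "?a * ?z = s * w n"
            unfolding z fg [symmetric] by simp
          ultimately have "\<bar>1 - ?a * ?z\<bar> = 1 - s * w n"
            using s by simp
          moreover have "\<bar>?z\<bar> * (1 - 2 * \<bar>?a\<bar>) \<le> s"
            using s small [of n] by (simp add: z g_def abs_mult abs_sgn_eq)
          moreover have "\<bar>?z\<bar> * \<bar>?a\<bar> = s * w n"
            using az s w(2) [of n] by (metis abs_mult abs_of_nonneg less_imp_le mult.commute mult_nonneg_nonneg)
          ultimately show ?thesis by (simp add: algebra_simps)
        next
          case False
          \<comment> \<open>In the constant tail the triangle inequality suffices: the two terms in
            \<open>\<bar>?z\<bar> * \<bar>?a\<bar>\<close> cancel and leave
            \<open>1 + \<bar>?z\<bar>\<close>.\<close>
          then have "\<bar>?z\<bar> \<le> s"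
            using s by (simp add: y_def seq_of_splice_const scaleR_conv_seq.rep_eq abs_mult abs_sgn_eq)
          moreover have "\<bar>1 - ?a * ?z\<bar> \<le> 1 + \<bar>?z\<bar> * \<bar>?a\<bar>"
            using abs_triangle_ineq4 [of 1 "?a * ?z"] by (simp add: abs_mult mult.commute)
          ultimately show ?thesis by (simp add: algebra_simps)
        qed
        then have "(\<bar>1 - ?a * ?z\<bar> + \<bar>?z\<bar> * (1 - \<bar>?a\<bar>)) * norm x \<le> (1 + s) * norm x"
          by (rule mult_right_mono) simp
        with abs_seq_of_proj_le [OF f, of "s *\<^sub>R y N" x n]
        show "\<bar>seq_of (proj f (s *\<^sub>R y N) x) n\<bar> \<le> (1 + s) * norm x"
          unfolding norm by linarith
      qed
    qed (use s in simp)
    ultimately show ?case by (simp add: s_def)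
  qed
  moreover have "(\<lambda>N. inverse (T N)) \<longlonglongrightarrow> inverse S"
    using T S by (intro tendsto_inverse) auto
  ultimately show thesis by (intro that)
qed

section \<open>The value of the infimum\<close>

theorem proposition2p3:
  fixes f :: "nat \<Rightarrow> real"
  assumes "f \<in> ell1"
    and "ell1_norm f = 1"
    and "\<And>j. j \<ge> 2 \<Longrightarrow> \<bar>f j\<bar> < 1 / 2"
  shows "(INF z\<in>functional f -` {1}. onorm (proj f z)) =
    1 + inverse (\<bar>f 1\<bar> + (\<Sum>j. \<bar>f (j + 2)\<bar> / (1 - 2 * \<bar>f (j + 2)\<bar>)))"
proof -
  define S where "S = \<bar>f 1\<bar> + (\<Sum>j. \<bar>f (j + 2)\<bar> / (1 - 2 * \<bar>f (j + 2)\<bar>))"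
  have small: "\<bar>f (n + 2)\<bar> < 1 / 2" for n
    by (rule assms(3)) simp
  \<comment> \<open>Each weight dominates its coefficient, so \<open>S\<close> is at least
    \<open>ell1_norm f = 1\<close>.\<close>
  have "(\<Sum>n. \<bar>f (n + 2)\<bar>) \<le> (\<Sum>n. \<bar>f (n + 2)\<bar> / (1 - 2 * \<bar>f (n + 2)\<bar>))"
  proof (intro suminf_le ell1_summable summable_weights assms)
    fix n
    show "\<bar>f (n + 2)\<bar> \<le> \<bar>f (n + 2)\<bar> / (1 - 2 * \<bar>f (n + 2)\<bar>)"
      using small [of n] by (simp add: pos_le_divide_eq algebra_simps)
  qed
  then have S: "S > 0"
    using ell1_norm_split [OF assms(1)] assms(2) by (simp add: S_def)
  have lower: "1 + inverse S \<le> onorm (proj f z)" if "functional f z = 1" for z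
  proof -
    have "1 \<le> (onorm (proj f z) - 1) * S"
      unfolding S_def by (rule onorm_proj_lower_bound [OF assms(1,2) small that])
    then have "1 / S \<le> onorm (proj f z) - 1"
      using S by (simp add: pos_divide_le_eq)
    then show ?thesis by (simp add: inverse_eq_divide)
  qed
  obtain s z where s: "s \<longlonglongrightarrow> inverse S" and z: "\<forall>\<^sub>F N in sequentially.
      functional f (z N) = 1 \<and> onorm (proj f (z N)) \<le> 1 + s N"
    using exists_near_optimal [OF assms(1,2) small] S unfolding S_def by blast
  have "(INF z\<in>functional f -` {1}. onorm (proj f z)) = 1 + inverse S"
  proof (rule antisym)
    show "(INF z\<in>functional f -` {1}. onorm (proj f z)) \<le> 1 + inverse S"
    proof (rule tendsto_lowerbound)
      show "(\<lambda>N. 1 + s N) \<longlonglongrightarrow> 1 + inverse S"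
        by (intro tendsto_intros s)
      show "\<forall>\<^sub>F N in sequentially. (INF z\<in>functional f -` {1}. onorm (proj f z)) \<le> 1 + s N"
        using z
      proof eventually_elim
        case (elim N)
        \<comment> \<open>A real infimum bounds its members from below only for a set bounded below;
          \<open>lower\<close> provides that bound.\<close>
        then show ?case
          by (intro cINF_lower2 [of _ _ "z N"] bdd_belowI2 [of _ "1 + inverse S"])
            (auto intro: lower)
      qed
    qed simp
    show "1 + inverse S \<le> (INF z\<in>functional f -` {1}. onorm (proj f z))"
    proof (rule cINF_greatest)
      show "functional f -` {1} \<noteq> {}"
        using eventually_happens [OF z] by auto
    qed (auto intro: lower)
  qed
  then show ?thesis by (simp add: S_def)
qed

end
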